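(* Let $U_1,\dots,U_n$ be ultrafilters on $\omega$ and let $I=(U_1\cap\cdots\cap U_n)^*$. Then for each $1\le i\le n$, $U_i$ has the $I$-pseudo intersection property: for every sequence $\langle X_k:k<\omega\rangle$ of elements of $U_i$ there is $X\in U_i$ such that $X\setminus X_k\in I$ for every $k<\omega$. In particular, $U_i^\omega\le_T U_i\times I^\omega$ for each $i$.
   Context: For a filter $F$ on $\omega$, $F^*=\{\omega\setminus A:A\in F\}$ is its dual ideal; ideals are ordered by inclusion and ultrafilters by reverse inclusion; $P^\omega$ and products are ordered coordinatewise. $P\le_T Q$ (Tukey) means there is a map $Q\to P$ sending cofinal subsets to cofinal subsets. *)

theory Defs
  imports Complex_Main
begin

text \<open>
  Filters on \<open>\<omega>\<close> are the library's \<^typ>\<open>nat filter\<close>. That type also contains the improper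
  filter \<^const>\<open>bot\<close> (ruled out for ultrafilters below), and its order is already reversed, so
  families of sets are always compared explicitly through \<open>filter_sets\<close>. Principal
  ultrafilters are allowed.
\<close>

definition filter_sets :: "'a filter \<Rightarrow> 'a set set" where
  "filter_sets F = {A. \<forall>\<^sub>F x in F. x \<in> A}"

definition is_ultrafilter :: "'a filter \<Rightarrow> bool" where
  "is_ultrafilter F \<longleftrightarrow> F \<noteq> bot \<and> (\<forall>A. A \<in> filter_sets F \<or> UNIV - A \<in> filter_sets F)"

definition dual_ideal :: "'a set set \<Rightarrow> 'a set set" where
  "dual_ideal \<F> = {UNIV - A | A. A \<in> \<F>}"

definition pseudo_intersection_property :: "'a set set \<Rightarrow> 'a set set \<Rightarrow> bool" where
  "pseudo_intersection_property I \<U> \<longleftrightarrow>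
     (\<forall>X :: nat \<Rightarrow> 'a set. (\<forall>k. X k \<in> \<U>) \<longrightarrow> (\<exists>Y \<in> \<U>. \<forall>k. Y - X k \<in> I))"

text \<open>
  An ordered set is represented by its order relation \<open>r\<close>, with \<open>(a, b) \<in> r\<close> meaning
  \<open>a \<le> b\<close>; since \<open>r\<close> is reflexive, its underlying set is \<^term>\<open>Field r\<close>. The library's
  \<open>cofinal\<close> demands a strictly larger element and is not the notion needed here.
\<close>

definition cofinal_in :: "'a rel \<Rightarrow> 'a set \<Rightarrow> bool" where
  "cofinal_in r C \<longleftrightarrow> C \<subseteq> Field r \<and> (\<forall>a \<in> Field r. \<exists>c \<in> C. (a, c) \<in> r)"

definition tukey_le :: "'a rel \<Rightarrow> 'b rel \<Rightarrow> bool" (infix "\<le>\<^sub>T" 50) where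
  "P \<le>\<^sub>T Q \<longleftrightarrow>
     (\<exists>f. f ` Field Q \<subseteq> Field P \<and> (\<forall>C. cofinal_in Q C \<longrightarrow> cofinal_in P (f ` C)))"

definition prod_order :: "'a rel \<Rightarrow> 'b rel \<Rightarrow> ('a \<times> 'b) rel" (infixr "\<times>\<^sub>o" 80) where
  "r \<times>\<^sub>o s = {((a, b), (a', b')). (a, a') \<in> r \<and> (b, b') \<in> s}"

definition omega_power :: "'a rel \<Rightarrow> (nat \<Rightarrow> 'a) rel" where
  "omega_power r = {(f, g). \<forall>k. (f k, g k) \<in> r}"

abbreviation ideal_order :: "'a set set \<Rightarrow> 'a set rel" where
  "ideal_order I \<equiv> relation_of (\<subseteq>) I"

abbreviation ultrafilter_order :: "'a filter \<Rightarrow> 'a set rel" where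
  "ultrafilter_order U \<equiv> relation_of (\<supseteq>) (filter_sets U)"

lemma Field_relation_of_subset [simp]:
  "Field (relation_of (\<subseteq>) S) = S" "Field (relation_of (\<supseteq>) S) = S"
  by (auto simp: relation_of_def Field_def)

lemma Field_prod_order:
  "Refl r \<Longrightarrow> Refl s \<Longrightarrow> Field (r \<times>\<^sub>o s) = Field r \<times> Field s"
  by (fastforce simp: prod_order_def Field_def refl_on_def)

lemma Field_omega_power:
  assumes "Refl r"
  shows "Field (omega_power r) = {f. \<forall>k. f k \<in> Field r}"
proof -
  have "f \<in> Field (omega_power r)" if "\<forall>k. f k \<in> Field r" for f
  proof -
    have "(f, f) \<in> omega_power r"
      using that assms by (auto simp: omega_power_def refl_on_def)
    then show ?thesis by (rule FieldI1)
  qed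
  then show ?thesis by (auto simp: omega_power_def Field_def)
qed

lemma Partial_order_relation_of_subset:
  "Partial_order (relation_of (\<subseteq>) S)" "Partial_order (relation_of (\<supseteq>) S)"
  unfolding Field_relation_of_subset
  by (auto simp: partial_order_on_def preorder_on_def refl_on_def trans_def antisym_def
      relation_of_def)

end

theory Submission
  imports Defs
begin

text \<open>
  Finitely many ultrafilters other than \<open>U\<^sub>i\<close> can be separated from \<open>U\<^sub>i\<close> by a single
  set \<open>A \<in> U\<^sub>i\<close> whose complement lies in all of them. Then \<open>A - X \<in> I\<close> for every \<open>X \<in> U\<^sub>i\<close>, so \<open>A\<close>
  is a pseudo-intersection of every sequence in \<open>U\<^sub>i\<close>. The map \<open>(B, Z) \<mapsto> (B - Z\<^sub>k)\<^sub>k\<close> is monotone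
  with cofinal range: if \<open>Y\<close> is a pseudo-intersection of \<open>X\<close>, then \<open>(Y, (Y - X\<^sub>k)\<^sub>k)\<close> is sent
  to \<open>(Y \<inter> X\<^sub>k)\<^sub>k\<close>.
\<close>

lemma filter_sets_Int:
  "A \<in> filter_sets F \<Longrightarrow> B \<in> filter_sets F \<Longrightarrow> A \<inter> B \<in> filter_sets F"
  by (simp add: filter_sets_def eventually_conj)

lemma filter_sets_mono:
  "A \<in> filter_sets F \<Longrightarrow> A \<subseteq> B \<Longrightarrow> B \<in> filter_sets F"
  unfolding filter_sets_def by (auto elim: eventually_mono)

lemma filter_sets_INT:
  "finite J \<Longrightarrow> (\<And>j. j \<in> J \<Longrightarrow> A j \<in> filter_sets F) \<Longrightarrow> (\<Inter>j\<in>J. A j) \<in> filter_sets F"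
  by (simp add: filter_sets_def eventually_ball_finite)

lemma mem_dual_ideal_iff: "A \<in> dual_ideal \<F> \<longleftrightarrow> UNIV - A \<in> \<F>"
proof
  assume "A \<in> dual_ideal \<F>"
  then obtain B where "A = UNIV - B" "B \<in> \<F>"
    unfolding dual_ideal_def by blast
  then show "UNIV - A \<in> \<F>"
    by (simp add: double_diff)
next
  assume "UNIV - A \<in> \<F>"
  moreover have "A = UNIV - (UNIV - A)" by blast
  ultimately show "A \<in> dual_ideal \<F>"
    unfolding dual_ideal_def by blast
qed

text \<open>Without a separating set, the dichotomy for \<open>G\<close> puts every member of
  \<open>F\<close> into \<open>G\<close>. A set \<open>B\<close> in \<open>G\<close> but not in
  \<open>F\<close> then has its complement in \<open>F\<close>, and that complement separates after
  all: ultrafilters are maximal.\<close>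

lemma ultrafilters_separated:
  assumes "is_ultrafilter F" "is_ultrafilter G" "filter_sets F \<noteq> filter_sets G"
  shows "\<exists>A \<in> filter_sets F. UNIV - A \<in> filter_sets G"
proof (rule ccontr)
  assume neg: "\<not> ?thesis"
  then have "filter_sets F \<subseteq> filter_sets G"
    using assms(2) unfolding is_ultrafilter_def by (meson subsetI)
  with assms(3) obtain B where B: "B \<in> filter_sets G" "B \<notin> filter_sets F"
    by blast
  then have "UNIV - B \<in> filter_sets F"
    using assms(1) unfolding is_ultrafilter_def by blast
  moreover have "UNIV - (UNIV - B) = B" by blast
  ultimately show False
    using B(1) neg by metis
qed

lemma pseudo_intersection_property_finite_Inter:
  assumes "finite J" "i \<in> J" and U: "\<And>j. j \<in> J \<Longrightarrow> is_ultrafilter (U j)"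
  shows "pseudo_intersection_property (dual_ideal (\<Inter>j\<in>J. filter_sets (U j))) (filter_sets (U i))"
proof -
  \<comment> \<open>The comparison is between families of sets, not indices: \<open>U\<close> may
    list the same ultrafilter repeatedly, and such copies cannot be separated.\<close>
  let ?K = "{j \<in> J. filter_sets (U i) \<noteq> filter_sets (U j)}"
  have "\<forall>j\<in>?K. \<exists>A. A \<in> filter_sets (U i) \<and> UNIV - A \<in> filter_sets (U j)"
    using ultrafilters_separated U \<open>i \<in> J\<close> by fast
  from bchoice[OF this] obtain A where A: "\<And>j. j \<in> ?K \<Longrightarrow> A j \<in> filter_sets (U i)"
      "\<And>j. j \<in> ?K \<Longrightarrow> UNIV - A j \<in> filter_sets (U j)"
    by blast
  \<comment> \<open>\<open>Y\<close> is chosen before any sequence is given, so one set serves all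
    of them. If \<open>?K\<close> is empty, \<open>Y\<close> is \<open>UNIV\<close>.\<close>
  define Y where "Y = (\<Inter>j\<in>?K. A j)"
  have Y: "Y \<in> filter_sets (U i)"
    unfolding Y_def using \<open>finite J\<close> A(1) by (intro filter_sets_INT) auto
  have "Y - X \<in> dual_ideal (\<Inter>j\<in>J. filter_sets (U j))" if X: "X \<in> filter_sets (U i)" for X
    unfolding mem_dual_ideal_iff
  proof (rule INT_I)
    fix j assume "j \<in> J"
    show "UNIV - (Y - X) \<in> filter_sets (U j)"
    proof (cases "j \<in> ?K")
      case True
      then have "UNIV - A j \<subseteq> UNIV - (Y - X)"
        unfolding Y_def by blast
      then show ?thesis
        using A(2)[OF True] filter_sets_mono by blast
    next
      \<comment> \<open>Here \<open>U j\<close> has the same members as \<open>U i\<close>, so it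
        contains \<open>X\<close>, which is disjoint from \<open>Y - X\<close>.\<close>
      case False
      then have "X \<in> filter_sets (U j)"
        using X \<open>j \<in> J\<close> by simp
      then show ?thesis
        by (rule filter_sets_mono) blast
    qed
  qed
  with Y show ?thesis
    unfolding pseudo_intersection_property_def by blast
qed

text \<open>Given \<open>p\<close> below \<open>f q\<close>, a cofinal \<open>C\<close> has some
  \<open>c\<close> above \<open>q\<close>, and monotonicity gives \<open>p\<close> below
  \<open>f q\<close> below \<open>f c\<close>.\<close>

lemma tukey_le_monotone:
  assumes "trans P"
    and "f ` Field Q \<subseteq> Field P"
    and mono: "\<And>a b. (a, b) \<in> Q \<Longrightarrow> (f a, f b) \<in> P"
    and cofinal: "\<And>p. p \<in> Field P \<Longrightarrow> \<exists>q \<in> Field Q. (p, f q) \<in> P"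
  shows "P \<le>\<^sub>T Q"
  unfolding tukey_le_def
proof (intro exI conjI allI impI)
  fix C assume C: "cofinal_in Q C"
  show "cofinal_in P (f ` C)"
    unfolding cofinal_in_def
  proof
    show "f ` C \<subseteq> Field P"
      using C assms(2) unfolding cofinal_in_def by blast
    show "\<forall>p \<in> Field P. \<exists>c \<in> f ` C. (p, c) \<in> P"
    proof
      fix p assume "p \<in> Field P"
      then obtain q where q: "q \<in> Field Q" "(p, f q) \<in> P" using cofinal by blast
      then obtain c where "c \<in> C" "(q, c) \<in> Q" using C unfolding cofinal_in_def by blast
      then show "\<exists>c \<in> f ` C. (p, c) \<in> P"
        using mono q(2) transD[OF \<open>trans P\<close>] by blast
    qed
  qed
qed (fact assms(2))

lemma trans_omega_power: "trans r \<Longrightarrow> trans (omega_power r)"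
  unfolding omega_power_def trans_def by blast

lemma Refl_omega_power: "Refl r \<Longrightarrow> Refl (omega_power r)"
  by (simp add: refl_on_def Field_omega_power) (simp add: omega_power_def)

text \<open>The inclusion keeps the values of the map inside \<open>filter_sets U\<close>; the
  pseudo-intersection property makes its range cofinal.\<close>

lemma tukey_le_of_pseudo_intersection_property:
  assumes "\<F> \<subseteq> filter_sets U"
    and pip: "pseudo_intersection_property (dual_ideal \<F>) (filter_sets U)"
  shows "omega_power (ultrafilter_order U) \<le>\<^sub>T
    ultrafilter_order U \<times>\<^sub>o omega_power (ideal_order (dual_ideal \<F>))"
    (is "?P \<le>\<^sub>T ?Q")
proof -
  let ?f = "\<lambda>(B, Z) k :: nat. B - Z k"
  have refl: "Refl (ultrafilter_order U)" "Refl (ideal_order (dual_ideal \<F>))"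
    unfolding refl_on_def Field_relation_of_subset by (auto simp: relation_of_def)
  have FP: "Field ?P = {X. \<forall>k. X k \<in> filter_sets U}"
    using Field_omega_power[OF refl(1)] by simp
  have FQ: "Field ?Q = filter_sets U \<times> {Z. \<forall>k. Z k \<in> dual_ideal \<F>}"
    using Field_prod_order[OF refl(1) Refl_omega_power[OF refl(2)]]
      Field_omega_power[OF refl(2)] by simp
  \<comment> \<open>The complement of \<open>Z\<close> lies in \<open>\<F>\<close>, hence in
    \<open>filter_sets U\<close>.\<close>
  have diff: "B - Z \<in> filter_sets U" if "B \<in> filter_sets U" "Z \<in> dual_ideal \<F>" for B Z
  proof -
    have "B \<inter> (UNIV - Z) \<in> filter_sets U"
      using that assms(1) by (intro filter_sets_Int) (auto simp: mem_dual_ideal_iff)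
    moreover have "B \<inter> (UNIV - Z) = B - Z" by blast
    ultimately show ?thesis by simp
  qed
  show ?thesis
  proof (rule tukey_le_monotone[where f = ?f])
    show "trans ?P"
      by (intro trans_omega_power transI) (auto simp: relation_of_def)
    show "?f ` Field ?Q \<subseteq> Field ?P"
      unfolding FP FQ using diff by auto
    show "(?f a, ?f b) \<in> ?P" if "(a, b) \<in> ?Q" for a b
    proof -
      obtain B Z B' Z' where ab: "a = (B, Z)" "b = (B', Z')" by fastforce
      with that have *: "B \<in> filter_sets U" "B' \<in> filter_sets U" "B' \<subseteq> B"
          "Z k \<in> dual_ideal \<F>" "Z' k \<in> dual_ideal \<F>" "Z k \<subseteq> Z' k" for k
        by (simp_all add: prod_order_def omega_power_def relation_of_def)
      \<comment> \<open>Going up in \<open>?Q\<close> shrinks \<open>B\<close> and enlarges each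
        \<open>Z k\<close>. Both shrink the difference, which is going up in
        \<open>?P\<close>.\<close>
      have "B' - Z' k \<subseteq> B - Z k" for k
        using *(3,6) by blast
      then show ?thesis
        using * diff by (simp add: ab omega_power_def relation_of_def)
    qed
    show "\<exists>q \<in> Field ?Q. (X, ?f q) \<in> ?P" if "X \<in> Field ?P" for X
    proof -
      have X: "X k \<in> filter_sets U" for k
        using that unfolding FP by blast
      then obtain Y where Y: "Y \<in> filter_sets U" "\<And>k. Y - X k \<in> dual_ideal \<F>"
        using pip unfolding pseudo_intersection_property_def by meson
      have "(Y, \<lambda>k. Y - X k) \<in> Field ?Q"
        unfolding FQ using Y by simp
      moreover have "(X, ?f (Y, \<lambda>k. Y - X k)) \<in> ?P"
        using X diff[OF Y(1) Y(2)] by (auto simp: omega_power_def relation_of_def)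
      ultimately show ?thesis by blast
    qed
  qed
qed

theorem theorem3p13:
  fixes U :: "nat \<Rightarrow> nat filter" and n :: nat and I :: "nat set set"
  assumes "\<And>i. i \<in> {1..n} \<Longrightarrow> is_ultrafilter (U i)"
    and "I = dual_ideal (\<Inter>i\<in>{1..n}. filter_sets (U i))"
  shows "\<forall>i\<in>{1..n}.
      pseudo_intersection_property I (filter_sets (U i)) \<and>
      omega_power (ultrafilter_order (U i)) \<le>\<^sub>T
        ultrafilter_order (U i) \<times>\<^sub>o omega_power (ideal_order I)"
proof
  fix i assume i: "i \<in> {1..n}"
  have pip: "pseudo_intersection_property I (filter_sets (U i))"
    unfolding assms(2) using i assms(1)
    by (intro pseudo_intersection_property_finite_Inter) auto
  moreover have "omega_power (ultrafilter_order (U i)) \<le>\<^sub>T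
      ultrafilter_order (U i) \<times>\<^sub>o omega_power (ideal_order I)"
    unfolding assms(2)
    \<comment> \<open>The intersection lies inside \<open>filter_sets (U i)\<close> because
      \<open>i\<close> is one of its indices.\<close>
    by (rule tukey_le_of_pseudo_intersection_property)
      (use i pip in \<open>auto simp: assms(2)\<close>)
  ultimately show "pseudo_intersection_property I (filter_sets (U i)) \<and>
      omega_power (ultrafilter_order (U i)) \<le>\<^sub>T
        ultrafilter_order (U i) \<times>\<^sub>o omega_power (ideal_order I)" ..
qed

end
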